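(* Let $f:\mathbb{R}^n\to\mathbb{R}$ be differentiable, $\mu$-strongly convex and $L$-smooth, with condition number $C_f=L/\mu$. Set $w=\dfrac{1}{1+\sqrt{C_f}}$, and let $(x_k)_{k\ge 0}$, $(v_k)_{k\ge0}$, $(y_k)_{k\ge0}$ be sequences in $\mathbb{R}^n$ satisfying, for all $k\ge 0$, $$y_k=(1-w)x_k+w v_k,$$ $$x_{k+1}-x_k=w(v_k-x_k)-\frac1L\nabla f(y_k),$$ $$v_{k+1}-v_k=w(x_k-v_k)-\frac{\sqrt{C_f}}{L}\nabla f(y_k).$$ Then $(x_k,y_k)$ follows Nesterov's accelerated gradient method for the strongly convex case, i.e. for all $k\ge0$, $$x_{k+1}=y_k-\frac1L\nabla f(y_k),\qquad y_{k+1}=x_{k+1}+\beta\,(x_{k+1}-x_k),\qquad \beta=\frac{\sqrt{C_f}-1}{\sqrt{C_f}+1}.$$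
   Context: $f$ is $L$-smooth if $f(y)-f(x)+\nabla f(x)\cdot(x-y)\le \frac L2|x-y|^2$ for all $x,y$. $f$ is $\mu$-strongly convex ($\mu>0$) if $f(x)+\nabla f(x)\cdot(y-x)\le f(y)-\frac\mu2|x-y|^2$ for all $x,y$. *)

theory Defs
  imports "HOL-Analysis.Analysis"
begin

text \<open>The gradient vector as a function. It is unspecified at points where \<open>f\<close> is not
  differentiable; the two lemmas below show that it is the intended vector wherever \<open>f\<close> is.\<close>

definition gradient :: "('a::euclidean_space \<Rightarrow> real) \<Rightarrow> 'a \<Rightarrow> 'a" where
  "gradient f x = (THE D. GDERIV f x :> D)"

lemma gradient_eqI:
  assumes "GDERIV f x :> D"
  shows "gradient f x = D"
  unfolding gradient_def
proof (rule the_equality[where P = "\<lambda>D. GDERIV f x :> D"])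
  show "GDERIV f x :> D" by (rule assms)
next
  fix E assume "GDERIV f x :> E"
  with assms have "(\<lambda>h. h \<bullet> E) = (\<lambda>h. h \<bullet> D)"
    unfolding gderiv_def by (blast intro: has_derivative_unique)
  then have "\<And>h. h \<bullet> E = h \<bullet> D" by meson
  then show "E = D" using vector_eq_ldot by blast
qed

lemma GDERIV_gradient:
  assumes "f differentiable at x"
  shows "GDERIV f x :> gradient f x"
proof -
  from assms obtain f' where f': "(f has_derivative f') (at x)"
    unfolding differentiable_def by blast
  then interpret linear f' by (rule has_derivative_linear)
  have "f' h = h \<bullet> (\<Sum>b\<in>Basis. f' b *\<^sub>R b)" for h
  proof -
    have "f' h = f' (\<Sum>b\<in>Basis. (h \<bullet> b) *\<^sub>R b)" by (simp add: euclidean_representation)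
    also have "\<dots> = h \<bullet> (\<Sum>b\<in>Basis. f' b *\<^sub>R b)"
      by (simp add: sum scale inner_sum_right mult.commute)
    finally show ?thesis .
  qed
  then have "f' = (\<lambda>h. h \<bullet> (\<Sum>b\<in>Basis. f' b *\<^sub>R b))" by blast
  with f' have "GDERIV f x :> (\<Sum>b\<in>Basis. f' b *\<^sub>R b)"
    unfolding gderiv_def by simp
  then show ?thesis using gradient_eqI by metis
qed

text \<open>Both notions are meant for differentiable \<open>f\<close>; differentiability is assumed separately.\<close>

definition L_smooth :: "real \<Rightarrow> ('a::euclidean_space \<Rightarrow> real) \<Rightarrow> bool" where
  "L_smooth L f \<longleftrightarrow>
    (\<forall>x y. f y - f x + gradient f x \<bullet> (x - y) \<le> L / 2 * (norm (x - y))\<^sup>2)"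

definition strongly_convex :: "real \<Rightarrow> ('a::euclidean_space \<Rightarrow> real) \<Rightarrow> bool" where
  "strongly_convex \<mu> f \<longleftrightarrow> \<mu> > 0 \<and>
    (\<forall>x y. f x + gradient f x \<bullet> (y - x) \<le> f y - \<mu> / 2 * (norm (x - y))\<^sup>2)"

end

theory Submission
  imports Defs
begin

text \<open>The two updates together give \<open>v\<^sub>k\<^sub>+\<^sub>1 - x\<^sub>k\<^sub>+\<^sub>1 = (sqrt C - 1) (x\<^sub>k\<^sub>+\<^sub>1 - x\<^sub>k)\<close>, because
  \<open>1 - 2 w = (sqrt C - 1) w\<close>. Multiplying it by \<open>w\<close> turns the extrapolation of \<open>x\<close> towards \<open>v\<close>
  into Nesterov's momentum term.\<close>

lemma coupled_step_momentum:
  fixes x v g x' v' :: "'a::real_vector" and s w :: real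
  assumes w: "w = 1 / (1 + s)"
    and x': "x' - x = w *\<^sub>R (v - x) - g"
    and v': "v' - v = w *\<^sub>R (x - v) - s *\<^sub>R g"
  shows "w *\<^sub>R (v' - x') = ((s - 1) / (s + 1)) *\<^sub>R (x' - x)"
proof (cases "1 + s = 0")
  case True
  \<comment> \<open>Division by zero: here both \<open>w\<close> and the momentum coefficient are \<open>0\<close>.\<close>
  then show ?thesis using w by (simp add: add.commute)
next
  case False
  then have coeff: "1 - 2 * w = (s - 1) * w"
    using w by (simp add: field_simps)
  have "v' - x' = (v - x) + (v' - v) - (x' - x)" by simp
  \<comment> \<open>The coupling terms have opposite signs in the two updates, so the gap
    \<open>v - x\<close> shrinks by \<open>w\<close> twice.\<close>
  also have "\<dots> = (1 - 2 * w) *\<^sub>R (v - x) - (s - 1) *\<^sub>R g"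
    unfolding x' v' by (simp add: algebra_simps flip: scaleR_2)
  also have "\<dots> = (s - 1) *\<^sub>R (x' - x)"
    unfolding coeff x' by (simp add: scaleR_right_diff_distrib)
  finally show ?thesis using w by (simp add: add.commute)
qed

theorem proposition2p1:
  fixes f :: "real ^ 'n \<Rightarrow> real"
    and L \<mu> C w \<beta> :: real
    and x v y :: "nat \<Rightarrow> real ^ 'n"
  assumes "\<forall>z. f differentiable at z"
    and "strongly_convex \<mu> f"
    and "L_smooth L f"
    and "C = L / \<mu>"
    and "w = 1 / (1 + sqrt C)"
    and "\<beta> = (sqrt C - 1) / (sqrt C + 1)"
    and "\<forall>k. y k = (1 - w) *\<^sub>R x k + w *\<^sub>R v k"
    and "\<forall>k. x (Suc k) - x k = w *\<^sub>R (v k - x k) - (1 / L) *\<^sub>R gradient f (y k)"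
    and "\<forall>k. v (Suc k) - v k = w *\<^sub>R (x k - v k) - (sqrt C / L) *\<^sub>R gradient f (y k)"
  shows "\<forall>k. x (Suc k) = y k - (1 / L) *\<^sub>R gradient f (y k)
           \<and> y (Suc k) = x (Suc k) + \<beta> *\<^sub>R (x (Suc k) - x k)"
proof (intro allI conjI)
  fix k
  \<comment> \<open>\<open>y_eq\<close> is used at two indices: at \<open>k\<close> it turns the
    \<open>x\<close> update into a gradient step from \<open>y k\<close>, at \<open>Suc k\<close> it
    exposes the momentum term.\<close>
  have x_Suc: "x (Suc k) - x k = w *\<^sub>R (v k - x k) - (1 / L) *\<^sub>R gradient f (y k)"
    and y_eq: "y j = x j + w *\<^sub>R (v j - x j)" for j
    using assms(7,8) by (simp_all add: algebra_simps)
  have "x (Suc k) = x k + (x (Suc k) - x k)" by simp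
  also have "\<dots> = y k - (1 / L) *\<^sub>R gradient f (y k)"
    by (simp only: x_Suc y_eq add_diff_eq)
  finally show "x (Suc k) = y k - (1 / L) *\<^sub>R gradient f (y k)" .
  \<comment> \<open>Both updates must share one vector \<open>g\<close>, the scaled gradient step;
    the factor left over in the \<open>v\<close> update is \<open>s = sqrt C\<close>.\<close>
  have "v (Suc k) - v k = w *\<^sub>R (x k - v k) - sqrt C *\<^sub>R ((1 / L) *\<^sub>R gradient f (y k))"
    using assms(9) by simp
  from coupled_step_momentum[OF assms(5) x_Suc this]
  show "y (Suc k) = x (Suc k) + \<beta> *\<^sub>R (x (Suc k) - x k)"
    using y_eq[of "Suc k"] assms(6) by simp
qed

end
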